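(* For any discrete random variable $X$ with support of (finite) cardinality $N\ge 3$, $$S_\alpha(X)\ \ge\ JS_\alpha(X)\quad\text{if } 0<\alpha<2,$$ $$S_\alpha(X)\ \le\ JS_\alpha(X)\quad\text{if } \alpha>2,$$ where for $\alpha=1$ the quantities $S_1(X)$ and $JS_1(X)$ are understood as the limits as $\alpha\to1$, namely the Shannon entropy $H(X)$ and the extropy $J(X)$.
   Context: $X$ is a discrete random variable with support $S=\{x_1,\dots,x_N\}$ and probability vector $\mathbf p=(p_1,\dots,p_N)$, $p_i=\mathbb P(X=x_i)\ge 0$, $\sum_{i=1}^N p_i=1$ (zero entries are allowed, e.g. the vector $(1,0,\dots,0)$ is admitted). For $\alpha>0$, $\alpha\neq1$, the Tsallis entropy and the Tsallis extropy of $X$ are $$S_\alpha(X)=\frac{1}{\alpha-1}\left(1-\sum_{i=1}^N p_i^\alpha\right),\qquad JS_\alpha(X)=\frac{1}{\alpha-1}\left(N-1-\sum_{i=1}^N(1-p_i)^\alpha\right).$$ The Shannon entropy and the extropy are $H(X)=-\sum_{i=1}^N p_i\log p_i$ and $J(X)=-\sum_{i=1}^N(1-p_i)\log(1-p_i)$, with $\log$ the natural logarithm and $0\log 0=0$. *)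

theory Defs
  imports "HOL-Probability.Probability"
begin

text \<open>
  The support \<open>S\<close> is explicit data: some of its points may carry probability \<open>0\<close>, so it cannot be
  recovered from the law of \<open>X\<close>, and the extropies depend on it through \<open>card S\<close>.
  Measurability is only required of the events \<open>X = x\<close> with \<open>x \<in> S\<close>; no \<open>\<sigma>\<close>-algebra on \<open>'a\<close> is fixed.
\<close>

definition prob_at :: "'w measure \<Rightarrow> ('w \<Rightarrow> 'a) \<Rightarrow> 'a \<Rightarrow> real" where
  "prob_at M X x = measure M {\<omega> \<in> space M. X \<omega> = x}"

definition discrete_rv :: "'w measure \<Rightarrow> ('w \<Rightarrow> 'a) \<Rightarrow> 'a set \<Rightarrow> bool" where
  "discrete_rv M X S \<longleftrightarrow>
     prob_space M \<and> finite S \<and>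
     (\<forall>x\<in>S. {\<omega> \<in> space M. X \<omega> = x} \<in> sets M) \<and> (AE \<omega> in M. X \<omega> \<in> S)"

definition shannon_entropy :: "'w measure \<Rightarrow> ('w \<Rightarrow> 'a) \<Rightarrow> 'a set \<Rightarrow> real" where
  "shannon_entropy M X S = - (\<Sum>x\<in>S. prob_at M X x * ln (prob_at M X x))"

definition extropy :: "'w measure \<Rightarrow> ('w \<Rightarrow> 'a) \<Rightarrow> 'a set \<Rightarrow> real" where
  "extropy M X S = - (\<Sum>x\<in>S. (1 - prob_at M X x) * ln (1 - prob_at M X x))"

text \<open>
  The values at \<open>\<alpha> = 1\<close> are the limits for \<open>\<alpha> \<rightarrow> 1\<close>; see \<open>tsallis_entropy_tendsto\<close> and
  \<open>tsallis_extropy_tendsto\<close> below.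
\<close>

definition tsallis_entropy :: "real \<Rightarrow> 'w measure \<Rightarrow> ('w \<Rightarrow> 'a) \<Rightarrow> 'a set \<Rightarrow> real" where
  "tsallis_entropy \<alpha> M X S =
     (if \<alpha> = 1 then shannon_entropy M X S
      else 1 / (\<alpha> - 1) * (1 - (\<Sum>x\<in>S. prob_at M X x powr \<alpha>)))"

definition tsallis_extropy :: "real \<Rightarrow> 'w measure \<Rightarrow> ('w \<Rightarrow> 'a) \<Rightarrow> 'a set \<Rightarrow> real" where
  "tsallis_extropy \<alpha> M X S =
     (if \<alpha> = 1 then extropy M X S
      else 1 / (\<alpha> - 1) * (real (card S) - 1 - (\<Sum>x\<in>S. (1 - prob_at M X x) powr \<alpha>)))"

lemma prob_at_nonneg: "0 \<le> prob_at M X x"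
  by (simp add: prob_at_def)

lemma prob_at_le_1: "discrete_rv M X S \<Longrightarrow> prob_at M X x \<le> 1"
  by (simp add: prob_at_def discrete_rv_def prob_space.prob_le_1)

lemma sum_prob_at:
  assumes "discrete_rv M X S"
  shows "(\<Sum>x\<in>S. prob_at M X x) = 1"
proof -
  interpret prob_space M using assms by (simp add: discrete_rv_def)
  let ?A = "\<lambda>x. {\<omega> \<in> space M. X \<omega> = x}"
  have fin: "finite S" and ev: "\<And>x. x \<in> S \<Longrightarrow> ?A x \<in> events"
    and ae: "AE \<omega> in M. X \<omega> \<in> S"
    using assms by (auto simp: discrete_rv_def)
  have "(\<Sum>x\<in>S. prob_at M X x) = prob (\<Union>x\<in>S. ?A x)"
    unfolding prob_at_def
    by (rule finite_measure_finite_Union[symmetric]) (use fin ev in \<open>auto simp: disjoint_family_on_def\<close>)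
  also have "\<dots> = 1"
    by (rule prob_eq_1[THEN iffD2]) (use fin ev ae in auto)
  finally show ?thesis .
qed

lemma sum_powr_quotient_tendsto:
  fixes q :: "'a \<Rightarrow> real"
  assumes "finite S" and nonneg: "\<And>x. x \<in> S \<Longrightarrow> 0 \<le> q x"
  shows "((\<lambda>\<alpha>. 1 / (\<alpha> - 1) * ((\<Sum>x\<in>S. q x) - (\<Sum>x\<in>S. q x powr \<alpha>)))
           \<longlongrightarrow> - (\<Sum>x\<in>S. q x * ln (q x))) (at 1)"
proof -
  have "((\<lambda>\<alpha>. q x powr \<alpha>) has_real_derivative q x * ln (q x)) (at 1)" if "x \<in> S" for x
  proof (cases "q x = 0")
    case False
    then have "q x > 0" using nonneg[OF that] by simp
    then show ?thesis by (auto intro!: derivative_eq_intros)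
  qed simp
  then have "((\<lambda>\<alpha>. \<Sum>x\<in>S. q x powr \<alpha>) has_real_derivative (\<Sum>x\<in>S. q x * ln (q x))) (at 1)"
    by (intro DERIV_sum)
  then have lim: "((\<lambda>\<alpha>. ((\<Sum>x\<in>S. q x powr \<alpha>) - (\<Sum>x\<in>S. q x powr 1)) / (\<alpha> - 1))
      \<longlongrightarrow> (\<Sum>x\<in>S. q x * ln (q x))) (at 1)"
    by (simp only: has_field_derivative_iff)
  have "(\<Sum>x\<in>S. q x powr 1) = (\<Sum>x\<in>S. q x)"
    using nonneg by (intro sum.cong) auto
  with tendsto_minus[OF lim] show ?thesis
    by (simp add: minus_divide_left)
qed

lemma tsallis_entropy_tendsto:
  assumes "discrete_rv M X S"
  shows "((\<lambda>\<alpha>. tsallis_entropy \<alpha> M X S) \<longlongrightarrow> shannon_entropy M X S) (at 1)"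
proof -
  have "((\<lambda>\<alpha>. 1 / (\<alpha> - 1) * (1 - (\<Sum>x\<in>S. prob_at M X x powr \<alpha>)))
          \<longlongrightarrow> shannon_entropy M X S) (at 1)"
    using sum_powr_quotient_tendsto[of S "prob_at M X"] assms
    by (simp add: sum_prob_at prob_at_nonneg shannon_entropy_def discrete_rv_def)
  then show ?thesis
    by (rule Lim_transform_eventually)
      (auto simp: tsallis_entropy_def eventually_at_filter)
qed

lemma tsallis_extropy_tendsto:
  assumes "discrete_rv M X S"
  shows "((\<lambda>\<alpha>. tsallis_extropy \<alpha> M X S) \<longlongrightarrow> extropy M X S) (at 1)"
proof -
  have "(\<Sum>x\<in>S. 1 - prob_at M X x) = real (card S) - 1"
    by (simp add: sum_subtractf sum_prob_at[OF assms])
  then have "((\<lambda>\<alpha>. 1 / (\<alpha> - 1) * (real (card S) - 1 - (\<Sum>x\<in>S. (1 - prob_at M X x) powr \<alpha>)))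
          \<longlongrightarrow> extropy M X S) (at 1)"
    using sum_powr_quotient_tendsto[of S "\<lambda>x. 1 - prob_at M X x"] prob_at_le_1[OF assms] assms
    by (simp add: extropy_def discrete_rv_def)
  then show ?thesis
    by (rule Lim_transform_eventually)
      (auto simp: tsallis_extropy_def eventually_at_filter)
qed

end

theory Submission imports Defs begin

text \<open>
  For \<open>\<alpha> \<noteq> 1\<close> the difference of the Tsallis entropy and the Tsallis extropy is the sum over the
  support of \<open>f p = (p - p powr \<alpha>) / (\<alpha> - 1) - ((1 - p) - (1 - p) powr \<alpha>) / (\<alpha> - 1)\<close>, because
  \<open>\<Sum>p = 1\<close> and \<open>\<Sum>(1 - p) = N - 1\<close>. This \<open>f\<close> vanishes at \<open>0\<close>, is antisymmetric about \<open>1/2\<close>, and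
  has second derivative \<open>\<alpha> * ((1 - p) powr (\<alpha> - 2) - p powr (\<alpha> - 2))\<close>. So on \<open>[0, 1/2]\<close> it is
  concave for \<open>0 < \<alpha> < 2\<close> and convex for \<open>\<alpha> > 2\<close>.

  A concave \<open>f\<close> with \<open>f 0 = 0\<close> lies above its chords through the origin: \<open>f p \<ge> (p / q) * f q\<close> for
  \<open>0 \<le> p \<le> q \<le> 1/2\<close>. If all probabilities are at most \<open>1/2\<close>, take \<open>q = 1/2\<close>, where \<open>f\<close> vanishes:
  every summand is nonnegative. Otherwise exactly one probability exceeds \<open>1/2\<close>; write it as \<open>1 - q\<close>.
  The others lie in \<open>[0, q]\<close> and add up to \<open>q\<close>, so the chord estimate gives them a total of at least
  \<open>f q\<close>, which cancels the remaining summand \<open>f (1 - q) = - f q\<close>. Hence the sum is nonnegative; for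
  \<open>\<alpha> > 2\<close> the same argument applies to \<open>- f\<close>.

  The case \<open>\<alpha> = 1\<close> is the limit of the inequality for \<open>\<alpha> \<rightarrow> 1\<close>.
\<close>

section \<open>Sums of functions antisymmetric about one half\<close>

text \<open>
  Concavity, in the form of an antitone derivative, is only known away from the endpoint \<open>0\<close>, where
  powers with exponent below \<open>1\<close> are not differentiable. The mean value theorem on
  \<open>[0, t * x]\<close> and on \<open>[t * x, x]\<close> needs only continuity there.
\<close>
lemma chord_le_of_antitone_deriv:
  fixes f f' :: "real \<Rightarrow> real"
  assumes cont: "continuous_on {0..b} f"
    and deriv: "\<And>x. 0 < x \<Longrightarrow> x < b \<Longrightarrow> (f has_real_derivative f' x) (at x)"
    and anti: "\<And>x y. 0 < x \<Longrightarrow> x \<le> y \<Longrightarrow> y < b \<Longrightarrow> f' y \<le> f' x"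
    and "f 0 = 0" and "0 \<le> t" "t \<le> 1" "0 \<le> x" "x \<le> b"
  shows "t * f x \<le> f (t * x)"
proof (cases "t = 0 \<or> t = 1 \<or> x = 0")
  case True
  then show ?thesis using \<open>f 0 = 0\<close> by auto
next
  case False
  then have t: "0 < t" "t < 1" and x: "0 < x" using assms by auto
  then have tx: "0 < t * x" "t * x < x" by auto
  obtain u where u: "0 < u" "u < t * x" "f (t * x) - f 0 = f' u * (t * x - 0)"
    by (rule mvt[OF tx(1), of f "\<lambda>x. (*) (f' x)"])
      (use tx \<open>x \<le> b\<close> in \<open>auto intro: continuous_on_subset[OF cont] deriv[THEN has_field_derivative_imp_has_derivative]\<close>)
  obtain v where v: "t * x < v" "v < x" "f x - f (t * x) = f' v * (x - t * x)"
    by (rule mvt[OF tx(2), of f "\<lambda>x. (*) (f' x)"])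
      (use tx \<open>x \<le> b\<close> in \<open>auto intro: continuous_on_subset[OF cont] deriv[THEN has_field_derivative_imp_has_derivative]\<close>)
  have "f' v \<le> f' u" using u v \<open>x \<le> b\<close> by (intro anti) auto
  then have "f' v * (t * (x - t * x)) \<le> f' u * (t * (x - t * x))"
    using t tx by (intro mult_right_mono) auto
  moreover have "t * (f x - f (t * x)) = f' v * (t * (x - t * x))"
    unfolding v(3) by (simp add: algebra_simps)
  moreover have "(1 - t) * f (t * x) = f' u * (t * (x - t * x))"
    using u(3) \<open>f 0 = 0\<close> by (simp add: algebra_simps)
  ultimately have "t * (f x - f (t * x)) \<le> (1 - t) * f (t * x)"
    by linarith
  then show ?thesis by (simp add: algebra_simps)
qed

text \<open>
  Only a value above \<open>1/2\<close> can contribute a negative summand, and there is at most one such value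
  \<open>1 - q\<close>. The remaining values form a splitting of \<open>q\<close>, on which the chord condition acts as
  subadditivity, so they compensate for \<open>f (1 - q) = - f q\<close>.
\<close>
lemma sum_nonneg_of_antisymmetric_chord:
  fixes f :: "real \<Rightarrow> real" and p :: "'a \<Rightarrow> real"
  assumes chord: "\<And>t x. 0 \<le> t \<Longrightarrow> t \<le> 1 \<Longrightarrow> 0 \<le> x \<Longrightarrow> x \<le> 1/2 \<Longrightarrow> t * f x \<le> f (t * x)"
    and antisym: "\<And>x. f (1 - x) = - f x" and "f 0 = 0"
    and "finite S" and nonneg: "\<And>i. i \<in> S \<Longrightarrow> 0 \<le> p i" and "(\<Sum>i\<in>S. p i) = 1"
  shows "0 \<le> (\<Sum>i\<in>S. f (p i))"
proof (cases "\<exists>k\<in>S. 1/2 < p k")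
  case False
  have "f (1/2) = 0" using antisym[of "1/2"] by simp
  have "0 \<le> f (p i)" if "i \<in> S" for i
    using chord[of "2 * p i" "1/2"] False nonneg[OF that] that \<open>f (1/2) = 0\<close> by force
  then show ?thesis by (rule sum_nonneg)
next
  case True
  then obtain k where k: "k \<in> S" "1/2 < p k" by blast
  define q where "q = (\<Sum>i\<in>S - {k}. p i)"
  have pk: "p k = 1 - q"
    using \<open>finite S\<close> k(1) \<open>(\<Sum>i\<in>S. p i) = 1\<close> by (simp add: q_def sum.remove)
  have le_q: "p i \<le> q" if "i \<in> S - {k}" for i
    unfolding q_def using that \<open>finite S\<close> nonneg by (intro member_le_sum) auto
  have "0 \<le> q" unfolding q_def using nonneg by (intro sum_nonneg) auto
  have "f q \<le> (\<Sum>i\<in>S - {k}. f (p i))"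
  proof (cases "q = 0")
    case True
    then have "p i = 0" if "i \<in> S - {k}" for i
      using le_q[OF that] nonneg that by force
    then show ?thesis using True \<open>f 0 = 0\<close> by simp
  next
    case False
    then have "0 < q" using \<open>0 \<le> q\<close> by simp
    then have "f q = (\<Sum>i\<in>S - {k}. p i / q * f q)"
      by (simp add: q_def flip: sum_distrib_right sum_divide_distrib)
    also have "\<dots> \<le> (\<Sum>i\<in>S - {k}. f (p i))"
    proof (rule sum_mono)
      fix i assume i: "i \<in> S - {k}"
      show "p i / q * f q \<le> f (p i)"
        using chord[of "p i / q" q] le_q[OF i] nonneg i \<open>0 < q\<close> k(2) pk by simp
    qed
    finally show ?thesis .
  qed
  then show ?thesis
    using \<open>finite S\<close> k(1) antisym[of q] by (simp add: sum.remove pk)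
qed

section \<open>The summand of the difference of entropy and extropy\<close>

definition entropy_gap :: "real \<Rightarrow> real \<Rightarrow> real" where
  "entropy_gap \<alpha> p = ((p - p powr \<alpha>) - ((1 - p) - (1 - p) powr \<alpha>)) / (\<alpha> - 1)"

lemma entropy_gap_antisym: "entropy_gap \<alpha> (1 - p) = - entropy_gap \<alpha> p"
  unfolding entropy_gap_def by (subst minus_divide_left) (simp add: algebra_simps)

lemma entropy_gap_0: "entropy_gap \<alpha> 0 = 0"
  by (simp add: entropy_gap_def)

lemma continuous_on_entropy_gap:
  assumes "0 < \<alpha>"
  shows "continuous_on {0..1/2} (entropy_gap \<alpha>)"
  unfolding entropy_gap_def
  using assms by (cases "\<alpha> = 1") (auto intro!: continuous_intros continuous_on_powr')

definition entropy_gap_deriv :: "real \<Rightarrow> real \<Rightarrow> real" where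
  "entropy_gap_deriv \<alpha> p = (2 - \<alpha> * p powr (\<alpha> - 1) - \<alpha> * (1 - p) powr (\<alpha> - 1)) / (\<alpha> - 1)"

lemma has_real_derivative_entropy_gap:
  assumes "\<alpha> \<noteq> 1" "0 < p" "p < 1"
  shows "(entropy_gap \<alpha> has_real_derivative entropy_gap_deriv \<alpha> p) (at p)"
  unfolding entropy_gap_def entropy_gap_deriv_def
  using assms by (auto intro!: derivative_eq_intros simp: divide_simps)

lemma has_real_derivative_entropy_gap_deriv:
  assumes "\<alpha> \<noteq> 1" "0 < p" "p < 1"
  shows "(entropy_gap_deriv \<alpha> has_real_derivative
           \<alpha> * ((1 - p) powr (\<alpha> - 2) - p powr (\<alpha> - 2))) (at p)"
proof -
  have "((\<lambda>x. 2 - \<alpha> * x powr (\<alpha> - 1) - \<alpha> * (1 - x) powr (\<alpha> - 1)) has_real_derivative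
      \<alpha> * ((1 - p) powr (\<alpha> - 2) - p powr (\<alpha> - 2)) * (\<alpha> - 1)) (at p)"
    using assms by (auto intro!: derivative_eq_intros simp: algebra_simps)
  from DERIV_cdivide[OF this, of "\<alpha> - 1"] show ?thesis
    unfolding entropy_gap_deriv_def using assms by simp
qed

text \<open>
  The sign \<open>s\<close> treats both ranges of \<open>\<alpha>\<close> at once: on \<open>(0, 1/2)\<close>, where \<open>p < 1 - p\<close>, the second
  derivative of \<open>entropy_gap \<alpha>\<close> is negative for \<open>\<alpha> < 2\<close> and positive for \<open>\<alpha> > 2\<close>.
\<close>
lemma signed_sum_entropy_gap_nonneg:
  fixes p :: "'a \<Rightarrow> real"
  assumes \<alpha>: "0 < \<alpha>" "\<alpha> \<noteq> 1" and s: "s = 1 \<and> \<alpha> < 2 \<or> s = -1 \<and> \<alpha> > 2"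
    and "finite S" and "\<And>i. i \<in> S \<Longrightarrow> 0 \<le> p i" and "(\<Sum>i\<in>S. p i) = 1"
  shows "0 \<le> s * (\<Sum>i\<in>S. entropy_gap \<alpha> (p i))"
proof -
  have anti: "s * entropy_gap_deriv \<alpha> y \<le> s * entropy_gap_deriv \<alpha> x"
    if xy: "0 < x" "x \<le> y" "y < 1/2" for x y
  proof (rule DERIV_nonpos_imp_nonincreasing[OF xy(2)])
    fix z assume "x \<le> z" "z \<le> y"
    then have z: "0 < z" "z \<le> 1 - z" "z < 1" using xy by auto
    have "((\<lambda>z. s * entropy_gap_deriv \<alpha> z) has_real_derivative
        s * (\<alpha> * ((1 - z) powr (\<alpha> - 2) - z powr (\<alpha> - 2)))) (at z)"
      by (intro DERIV_cmult has_real_derivative_entropy_gap_deriv \<alpha> z)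
    moreover have "s * (\<alpha> * ((1 - z) powr (\<alpha> - 2) - z powr (\<alpha> - 2))) \<le> 0"
      using s
    proof
      assume "s = 1 \<and> \<alpha> < 2"
      moreover then have "(1 - z) powr (\<alpha> - 2) \<le> z powr (\<alpha> - 2)"
        using z by (intro powr_mono2') auto
      ultimately show ?thesis using \<alpha> by (simp add: mult_le_0_iff)
    next
      assume "s = -1 \<and> \<alpha> > 2"
      moreover then have "z powr (\<alpha> - 2) \<le> (1 - z) powr (\<alpha> - 2)"
        using z by (intro powr_mono2) auto
      ultimately show ?thesis using \<alpha> by simp
    qed
    ultimately show "\<exists>d. ((\<lambda>z. s * entropy_gap_deriv \<alpha> z) has_real_derivative d) (at z) \<and> d \<le> 0"
      by blast
  qed
  have chord: "t * (s * entropy_gap \<alpha> x) \<le> s * entropy_gap \<alpha> (t * x)"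
    if "0 \<le> t" "t \<le> 1" "0 \<le> x" "x \<le> 1/2" for t x
    by (rule chord_le_of_antitone_deriv[where b = "1/2" and f = "\<lambda>x. s * entropy_gap \<alpha> x"
          and f' = "\<lambda>x. s * entropy_gap_deriv \<alpha> x"])
      (use that \<alpha> anti in \<open>auto simp: entropy_gap_0
        intro!: continuous_on_mult_left continuous_on_entropy_gap DERIV_cmult has_real_derivative_entropy_gap\<close>)
  have "0 \<le> (\<Sum>i\<in>S. s * entropy_gap \<alpha> (p i))"
    by (rule sum_nonneg_of_antisymmetric_chord[where f = "\<lambda>x. s * entropy_gap \<alpha> x"])
      (use chord assms(4-6) in \<open>auto simp: entropy_gap_0 entropy_gap_antisym\<close>)
  then show ?thesis by (simp add: sum_distrib_left)
qed

section \<open>Comparison of Tsallis entropy and extropy\<close>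

lemma tsallis_entropy_minus_extropy:
  assumes "discrete_rv M X S" and "\<alpha> \<noteq> 1"
  shows "tsallis_entropy \<alpha> M X S - tsallis_extropy \<alpha> M X S = (\<Sum>x\<in>S. entropy_gap \<alpha> (prob_at M X x))"
proof -
  have "(\<Sum>x\<in>S. entropy_gap \<alpha> (prob_at M X x)) =
      (((\<Sum>x\<in>S. prob_at M X x) - (\<Sum>x\<in>S. prob_at M X x powr \<alpha>))
        - ((real (card S) - (\<Sum>x\<in>S. prob_at M X x)) - (\<Sum>x\<in>S. (1 - prob_at M X x) powr \<alpha>))) / (\<alpha> - 1)"
    unfolding entropy_gap_def sum_divide_distrib[symmetric] sum_subtractf by simp
  then show ?thesis
    using assms(2) unfolding sum_prob_at[OF assms(1)]
    by (simp add: tsallis_entropy_def tsallis_extropy_def flip: diff_divide_distrib)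
qed

lemma signed_tsallis_difference_nonneg:
  assumes "discrete_rv M X S" and "0 < \<alpha>" "\<alpha> \<noteq> 1" and "s = 1 \<and> \<alpha> < 2 \<or> s = -1 \<and> \<alpha> > 2"
  shows "0 \<le> s * (tsallis_entropy \<alpha> M X S - tsallis_extropy \<alpha> M X S)"
  unfolding tsallis_entropy_minus_extropy[OF assms(1,3)]
  using assms by (intro signed_sum_entropy_gap_nonneg) (auto simp: prob_at_nonneg sum_prob_at discrete_rv_def)

lemma extropy_le_shannon_entropy:
  assumes "discrete_rv M X S"
  shows "extropy M X S \<le> shannon_entropy M X S"
proof (rule tendsto_le[OF _ tsallis_entropy_tendsto[OF assms] tsallis_extropy_tendsto[OF assms]])
  have "eventually (\<lambda>\<alpha>. \<alpha> \<in> {0<..<2} - {1}) (at (1::real))"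
    by (rule eventually_at_in_open) auto
  then show "eventually (\<lambda>\<alpha>. tsallis_extropy \<alpha> M X S \<le> tsallis_entropy \<alpha> M X S) (at 1)"
    by (rule eventually_mono) (use signed_tsallis_difference_nonneg[OF assms, of _ 1] in auto)
qed simp

theorem theorem2p1:
  fixes M :: "'w measure" and X :: "'w \<Rightarrow> 'a" and S :: "'a set" and \<alpha> :: real
  assumes "discrete_rv M X S" and "card S \<ge> 3"
  shows "(0 < \<alpha> \<and> \<alpha> < 2 \<longrightarrow> tsallis_entropy \<alpha> M X S \<ge> tsallis_extropy \<alpha> M X S) \<and>
         (\<alpha> > 2 \<longrightarrow> tsallis_entropy \<alpha> M X S \<le> tsallis_extropy \<alpha> M X S)"
proof (intro conjI impI)
  assume "0 < \<alpha> \<and> \<alpha> < 2"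
  then show "tsallis_entropy \<alpha> M X S \<ge> tsallis_extropy \<alpha> M X S"
    using extropy_le_shannon_entropy[OF assms(1)] signed_tsallis_difference_nonneg[OF assms(1), of \<alpha> 1]
    by (cases "\<alpha> = 1") (auto simp: tsallis_entropy_def[of 1] tsallis_extropy_def[of 1])
next
  assume "\<alpha> > 2"
  then show "tsallis_entropy \<alpha> M X S \<le> tsallis_extropy \<alpha> M X S"
    using signed_tsallis_difference_nonneg[OF assms(1), of \<alpha> "-1"] by simp
qed

end
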